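(* Let $(R,\delta,\alpha)$ be a regular $\delta$-Hom-Jordan Lie conformal superalgebra and let $f:R\to R$ be a Hom-Nijenhuis operator. Put $$\psi_{\lambda,-\partial-\lambda}(a,b)=[a_\lambda b]_N,\qquad a,b\in R,$$ where $[a_\lambda b]_N=[f(a)_\lambda b]+[a_\lambda f(b)]-f([a_\lambda b])$. Then $\psi$ generates a deformation of $(R,\delta,\alpha)$, that is, for every $t$ the $\lambda$-bracket $$[a_\lambda b]_t=[a_\lambda b]+t\,\psi_{\lambda,-\partial-\lambda}(a,b)$$ together with $\alpha$ makes $R$ a $\delta$-Hom-Jordan Lie conformal superalgebra. Furthermore, this deformation is trivial: with $T_t=\mathrm{id}+tf$ one has $T_t([a_\lambda b]_t)=[T_t(a)_\lambda T_t(b)]$ for all $a,b\in R$.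
   Context: All spaces are over $\mathbb{C}$, and $t\in\mathbb{C}$ is a parameter. $|a|\in\mathbb{Z}_2$ denotes the parity of a homogeneous element; identities containing parities are required for homogeneous elements. Convention: if $[b_\mu a]=\sum_i\mu^i c_i$ then $[b_{-\lambda-\partial}a]:=\sum_i(-\lambda-\partial)^i c_i$. Linear maps on $R$ are extended coefficientwise to $R[\lambda]$. A $\delta$-Hom-Jordan Lie conformal superalgebra ($\delta=\pm1$) is a $\mathbb{Z}_2$-graded $\mathbb{C}[\partial]$-module $R=R_{\bar0}\oplus R_{\bar1}$ with an even linear endomorphism $\alpha$ such that $\alpha\partial=\partial\alpha$, and a $\mathbb{C}$-linear map $R\otimes R\to\mathbb{C}[\lambda]\otimes R$, $a\otimes b\mapsto[a_\lambda b]$, with $[(R_\phi)_\lambda R_\varphi]\subseteq R_{\phi+\varphi}[\lambda]$ for $\phi,\varphi\in\mathbb{Z}_2$, such that for $a,b,c\in R$: (i) $[\partial a_\lambda b]=-\lambda[a_\lambda b]$, $[a_\lambda\partial b]=(\partial+\lambda)[a_\lambda b]$; (ii) $[a_\lambda b]=-\delta(-1)^{|a||b|}[b_{-\lambda-\partial}a]$; (iii) $[\alpha(a)_\lambda[b_\mu c]]=\delta[[a_\lambda b]_{\lambda+\mu}\alpha(c)]+\delta(-1)^{|a||b|}[\alpha(b)_\mu[a_\lambda c]]$. It is regular if $\alpha$ is an algebra isomorphism, i.e. $\alpha$ is bijective and $\alpha([a_\lambda b])=[\alpha(a)_\lambda\alpha(b)]$. A Hom-Nijenhuis operator on $R$ is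 an even $\mathbb{C}[\partial]$-linear map $f:R\to R$ with $f\alpha=\alpha f$ such that $[f(a)_\lambda f(b)]=f([a_\lambda b]_N)$ for all $a,b\in R$, where $[a_\lambda b]_N=[f(a)_\lambda b]+[a_\lambda f(b)]-f([a_\lambda b])$. *)

theory Defs
  imports
    "HOL-Computational_Algebra.Polynomial"
    "HOL-Library.Z2"
begin

text \<open>
  A \<open>\<complex>[\<partial>]\<close>-module is a module over the polynomial ring \<^typ>\<open>complex poly\<close> whose indeterminate is
  \<open>\<partial>\<close>; the complex vector space structure comes from the constant polynomials.
\<close>

definition cscale :: "(complex poly \<Rightarrow> 'a \<Rightarrow> 'a) \<Rightarrow> complex \<Rightarrow> 'a \<Rightarrow> 'a"
  where "cscale act c x = act [:c:] x"

definition ddel :: "(complex poly \<Rightarrow> 'a \<Rightarrow> 'a) \<Rightarrow> 'a \<Rightarrow> 'a"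
  where "ddel act x = act [:0, 1:] x"

text \<open>
  \<open>R[\<lambda>]\<close> is \<^typ>\<open>'a poly\<close>. Multiplication by \<open>\<lambda>\<close> is \<^term>\<open>pCons 0\<close>, and a linear map on \<open>R\<close> is
  extended coefficientwise to \<open>R[\<lambda>]\<close> by \<^const>\<open>map_poly\<close>.
\<close>

definition pscale :: "(complex poly \<Rightarrow> 'a \<Rightarrow> 'a) \<Rightarrow> complex \<Rightarrow> 'a::zero poly \<Rightarrow> 'a poly"
  where "pscale act c = map_poly (cscale act c)"

text \<open>
  \<open>R[\<lambda>,\<mu>]\<close> is \<^typ>\<open>'a poly poly\<close>, where \<open>\<mu>\<close> is the outer and \<open>\<lambda>\<close> the inner indeterminate.
\<close>

definition pscale2 :: "(complex poly \<Rightarrow> 'a \<Rightarrow> 'a) \<Rightarrow> complex \<Rightarrow> 'a::zero poly poly \<Rightarrow> 'a poly poly"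
  where "pscale2 act c = map_poly (pscale act c)"

definition mul_lam :: "'a::zero poly poly \<Rightarrow> 'a poly poly"
  where "mul_lam = map_poly (pCons 0)"

definition mul_mu :: "'a::zero poly poly \<Rightarrow> 'a poly poly"
  where "mul_mu = pCons 0"

definition const2 :: "'a::zero \<Rightarrow> 'a poly poly"
  where "const2 x = [:[:x:]:]"

text \<open>
  For \<open>p = \<Sum>i. \<nu>\<^sup>i c\<^sub>i\<close>, \<open>subst_op S e p\<close> is \<open>\<Sum>i. S\<^sup>i (e c\<^sub>i)\<close>: the indeterminate \<open>\<nu>\<close> is replaced by the
  operator \<open>S\<close>, and the coefficients are sent to the target by \<open>e\<close>.
\<close>

definition subst_op :: "('b \<Rightarrow> 'b) \<Rightarrow> ('a::zero \<Rightarrow> 'b::comm_monoid_add) \<Rightarrow> 'a poly \<Rightarrow> 'b"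
  where "subst_op S e p = (\<Sum>i\<le>degree p. (S ^^ i) (e (coeff p i)))"

text \<open>\<open>[b\<^bsub>-\<lambda>-\<partial>\<^esub> a]\<close>, with \<open>\<partial>\<close> acting on the coefficients:\<close>

definition swapped_bracket ::
    "(complex poly \<Rightarrow> 'a::ab_group_add \<Rightarrow> 'a) \<Rightarrow> ('a \<Rightarrow> 'a \<Rightarrow> 'a poly) \<Rightarrow> 'a \<Rightarrow> 'a \<Rightarrow> 'a poly"
  where "swapped_bracket act br b a =
    subst_op (\<lambda>p. - pCons 0 p - map_poly (ddel act) p) (\<lambda>x. [:x:]) (br b a)"

text \<open>The three iterated brackets \<open>[x\<^sub>\<lambda> [y\<^sub>\<mu> z]]\<close>, \<open>[y\<^sub>\<mu> [x\<^sub>\<lambda> z]]\<close>, \<open>[[x\<^sub>\<lambda> y]\<^bsub>\<lambda>+\<mu>\<^esub> z]\<close> in \<open>R[\<lambda>,\<mu>]\<close>:\<close>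

definition bracket_lam_mu ::
    "('a::ab_group_add \<Rightarrow> 'a \<Rightarrow> 'a poly) \<Rightarrow> 'a \<Rightarrow> 'a \<Rightarrow> 'a \<Rightarrow> 'a poly poly"
  where "bracket_lam_mu br x y z =
    subst_op mul_mu (\<lambda>w. subst_op mul_lam const2 (br x w)) (br y z)"

definition bracket_mu_lam ::
    "('a::ab_group_add \<Rightarrow> 'a \<Rightarrow> 'a poly) \<Rightarrow> 'a \<Rightarrow> 'a \<Rightarrow> 'a \<Rightarrow> 'a poly poly"
  where "bracket_mu_lam br y x z =
    subst_op mul_lam (\<lambda>w. subst_op mul_mu const2 (br y w)) (br x z)"

definition bracket_lam_plus_mu ::
    "('a::ab_group_add \<Rightarrow> 'a \<Rightarrow> 'a poly) \<Rightarrow> 'a \<Rightarrow> 'a \<Rightarrow> 'a \<Rightarrow> 'a poly poly"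
  where "bracket_lam_plus_mu br x y z =
    subst_op mul_lam (\<lambda>w. subst_op (\<lambda>q. mul_lam q + mul_mu q) const2 (br w z)) (br x y)"

text \<open>The sign \<open>(-1)\<^bsup>pq\<^esup>\<close>; \<open>\<int>\<^sub>2\<close> is the type \<^typ>\<open>bit\<close>.\<close>

definition psign :: "bit \<Rightarrow> bit \<Rightarrow> complex"
  where "psign p q = (if p = 1 \<and> q = 1 then - 1 else 1)"

text \<open>
  \<open>R\<close> is the whole type \<^typ>\<open>'a\<close>, \<open>Rg p\<close> is its homogeneous part of parity \<open>p\<close>, and the coefficient
  of \<open>\<lambda>\<^sup>n\<close> in \<open>[a\<^sub>\<lambda> b]\<close> is \<open>coeff (br a b) n\<close>.
\<close>

locale graded_del_module = module act
  for act :: "complex poly \<Rightarrow> 'a::ab_group_add \<Rightarrow> 'a" +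
  fixes Rg :: "bit \<Rightarrow> 'a set"
  assumes graded_submodule: "subspace (Rg p)"
    and graded_int: "Rg 0 \<inter> Rg 1 = {0}"
    and graded_sum: "\<exists>y\<in>Rg 0. \<exists>z\<in>Rg 1. x = y + z"

locale hom_jordan_lie_conformal_superalgebra = graded_del_module act Rg
  for act :: "complex poly \<Rightarrow> 'a::ab_group_add \<Rightarrow> 'a" and Rg :: "bit \<Rightarrow> 'a set" +
  fixes \<delta> :: complex
    and \<alpha> :: "'a \<Rightarrow> 'a"
    and br :: "'a \<Rightarrow> 'a \<Rightarrow> 'a poly"
  assumes delta: "\<delta> = 1 \<or> \<delta> = - 1"
    and alpha_linear: "Vector_Spaces.linear (cscale act) (cscale act) \<alpha>"
    and alpha_even: "\<alpha> ` Rg p \<subseteq> Rg p"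
    and alpha_ddel: "\<alpha> (ddel act a) = ddel act (\<alpha> a)"
    and br_linear_right: "Vector_Spaces.linear (cscale act) (pscale act) (\<lambda>b. br a b)"
    and br_linear_left: "Vector_Spaces.linear (cscale act) (pscale act) (\<lambda>a. br a b)"
    and br_graded: "a \<in> Rg p \<Longrightarrow> b \<in> Rg q \<Longrightarrow> coeff (br a b) n \<in> Rg (p + q)"
    and sesqui_left: "br (ddel act a) b = - pCons 0 (br a b)"
    and sesqui_right: "br a (ddel act b) = map_poly (ddel act) (br a b) + pCons 0 (br a b)"
    and skew: "a \<in> Rg p \<Longrightarrow> b \<in> Rg q \<Longrightarrow>
      br a b = pscale act (- \<delta> * psign p q) (swapped_bracket act br b a)"
    and hom_jacobi: "a \<in> Rg p \<Longrightarrow> b \<in> Rg q \<Longrightarrow> c \<in> Rg r \<Longrightarrow>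
      bracket_lam_mu br (\<alpha> a) b c =
        pscale2 act \<delta> (bracket_lam_plus_mu br a b (\<alpha> c)) +
        pscale2 act (\<delta> * psign p q) (bracket_mu_lam br (\<alpha> b) a c)"

locale regular_hom_jordan_lie_conformal_superalgebra =
  hom_jordan_lie_conformal_superalgebra act Rg \<delta> \<alpha> br
  for act :: "complex poly \<Rightarrow> 'a::ab_group_add \<Rightarrow> 'a" and Rg \<delta> \<alpha> br +
  assumes alpha_bij: "bij \<alpha>"
    and alpha_mult: "map_poly \<alpha> (br a b) = br (\<alpha> a) (\<alpha> b)"

definition nijenhuis_bracket ::
    "('a::ab_group_add \<Rightarrow> 'a \<Rightarrow> 'a poly) \<Rightarrow> ('a \<Rightarrow> 'a) \<Rightarrow> 'a \<Rightarrow> 'a \<Rightarrow> 'a poly"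
  where "nijenhuis_bracket br f a b = br (f a) b + br a (f b) - map_poly f (br a b)"

definition hom_nijenhuis_operator ::
    "(complex poly \<Rightarrow> 'a::ab_group_add \<Rightarrow> 'a) \<Rightarrow> (bit \<Rightarrow> 'a set) \<Rightarrow> ('a \<Rightarrow> 'a) \<Rightarrow>
     ('a \<Rightarrow> 'a \<Rightarrow> 'a poly) \<Rightarrow> ('a \<Rightarrow> 'a) \<Rightarrow> bool"
  where "hom_nijenhuis_operator act Rg \<alpha> br f \<longleftrightarrow>
    module_hom act act f \<and>
    (\<forall>p. f ` Rg p \<subseteq> Rg p) \<and>
    f \<circ> \<alpha> = \<alpha> \<circ> f \<and>
    (\<forall>a b. br (f a) (f b) = map_poly f (nijenhuis_bracket br f a b))"

text \<open>
  A cochain \<open>\<psi>\<close> is given by its values \<open>\<psi>\<^bsub>\<lambda>,-\<partial>-\<lambda>\<^esub>(a,b)\<close> in \<open>R[\<lambda>]\<close>.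
\<close>

definition deformed_bracket ::
    "(complex poly \<Rightarrow> 'a::ab_group_add \<Rightarrow> 'a) \<Rightarrow> ('a \<Rightarrow> 'a \<Rightarrow> 'a poly) \<Rightarrow>
     ('a \<Rightarrow> 'a \<Rightarrow> 'a poly) \<Rightarrow> complex \<Rightarrow> 'a \<Rightarrow> 'a \<Rightarrow> 'a poly"
  where "deformed_bracket act br \<psi> t a b = br a b + pscale act t (\<psi> a b)"

definition generates_deformation ::
    "(complex poly \<Rightarrow> 'a::ab_group_add \<Rightarrow> 'a) \<Rightarrow> (bit \<Rightarrow> 'a set) \<Rightarrow> complex \<Rightarrow> ('a \<Rightarrow> 'a) \<Rightarrow>
     ('a \<Rightarrow> 'a \<Rightarrow> 'a poly) \<Rightarrow> ('a \<Rightarrow> 'a \<Rightarrow> 'a poly) \<Rightarrow> bool"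
  where "generates_deformation act Rg \<delta> \<alpha> br \<psi> \<longleftrightarrow>
    (\<forall>t. hom_jordan_lie_conformal_superalgebra act Rg \<delta> \<alpha> (deformed_bracket act br \<psi> t))"

definition id_plus :: "(complex poly \<Rightarrow> 'a::ab_group_add \<Rightarrow> 'a) \<Rightarrow> ('a \<Rightarrow> 'a) \<Rightarrow> complex \<Rightarrow> 'a \<Rightarrow> 'a"
  where "id_plus act f t a = a + cscale act t (f a)"

end

theory Submission
  imports Defs
begin

text \<open>
  Write \<open>N\<close> for \<open>[\<cdot>,\<cdot>]\<^sub>N\<close>, \<open>[\<cdot>,\<cdot>]\<^sub>t = [\<cdot>,\<cdot>] + t N\<close> and \<open>T\<^sub>t = id + t f\<close>.
  The deformation is trivial because \<open>T\<^sub>t[a,b]\<^sub>t\<close> and \<open>[T\<^sub>t a, T\<^sub>t b]\<close> are polynomials in \<open>t\<close>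
  with the same coefficients: at \<open>t\<close> by definition of \<open>N\<close>, at \<open>t\<^sup>2\<close> by the Nijenhuis identity
  (\<open>id_plus_deformed_bracket\<close>).

  Grading, sesquilinearity and skew-symmetry are linear conditions on the bracket, and \<open>f\<close> respects
  the parity and \<open>\<partial>\<close>, so \<open>N\<close> inherits them and so does \<open>[\<cdot>,\<cdot>]\<^sub>t\<close>. The Jacobi identity is
  quadratic, and it is deduced from the triviality rather than computed. Since \<open>T\<^sub>t\<close> is multiplicative,
  commutes with \<open>\<alpha>\<close> and preserves parity, it maps the Jacobiator \<open>J\<^sub>t(a,b,c)\<close> of \<open>[\<cdot>,\<cdot>]\<^sub>t\<close> to the
  Jacobiator of \<open>[\<cdot>,\<cdot>]\<close> at \<open>(T\<^sub>t a, T\<^sub>t b, T\<^sub>t c)\<close>, which is \<open>0\<close> (\<open>jacobiator_natural\<close>). For a given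
  \<open>t\<close> this does not give \<open>J\<^sub>t = 0\<close>, as \<open>T\<^sub>t\<close> may fail to be injective. But the Jacobiator is
  bilinear in its outer and inner bracket (\<open>jacobiator_deform_outer\<close>, \<open>jacobiator_deform_inner\<close>) and
  vanishes at \<open>t = 0\<close>, hence \<open>J\<^sub>t = t A + t\<^sup>2 B\<close> with \<open>A\<close>, \<open>B\<close> independent of \<open>t\<close>. Thus
  \<open>(id + t f)(t A + t\<^sup>2 B) = 0\<close> for all \<open>t\<close>: morally, \<open>id + t f\<close> is invertible as a formal power series
  in \<open>t\<close>, so \<open>A = B = 0\<close> (\<open>quadratic_family_eq_0\<close>).

  The three iterated brackets in the Jacobi identity are two nested substitutions of an operator for
  an indeterminate, so bilinearity and naturality are proved once, for such nested substitutions.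
\<close>

section \<open>Coefficientwise extension of additive maps\<close>

lemma coeff_map_poly_additive:
  assumes "Modules.additive h"
  shows "coeff (map_poly h p) n = h (coeff p n)"
  by (rule coeff_map_poly) (rule additive.zero[OF assms])

lemma additive_map_poly:
  assumes "Modules.additive h"
  shows "Modules.additive (map_poly h)"
  by (intro additive.intro poly_eqI)
    (simp add: coeff_map_poly_additive[OF assms] additive.add[OF assms])

lemma map_poly_pCons_additive:
  assumes "Modules.additive h"
  shows "map_poly h (pCons x p) = pCons (h x) (map_poly h p)"
  by (rule map_poly_pCons) (rule additive.zero[OF assms])

lemma map_poly_commute:
  assumes "Modules.additive g" "Modules.additive h" "\<And>x. g (h x) = h (g x)"
  shows "map_poly g (map_poly h p) = map_poly h (map_poly g p)"
  by (intro poly_eqI) (simp add: coeff_map_poly_additive assms)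

lemma vector_space_additive:
  assumes "vector_space s"
  shows "Modules.additive (s c)"
  using assms by (intro additive.intro) (rule vector_space.vector_space_assms)

lemma vector_space_map_poly:
  assumes "vector_space s"
  shows "vector_space (\<lambda>c. map_poly (s c))"
  by (intro vector_space.intro poly_eqI)
    (simp_all add: coeff_map_poly_additive vector_space_additive[OF assms]
      vector_space.vector_space_assms[OF assms])

lemma linear_map_poly:
  assumes "Vector_Spaces.linear s s' h"
  shows "Vector_Spaces.linear (\<lambda>c. map_poly (s c)) (\<lambda>c. map_poly (s' c)) (map_poly h)"
proof -
  interpret h: Vector_Spaces.linear s s' h by fact
  have h: "Modules.additive h"
    by (intro additive.intro) (rule h.add)
  note [simp] = coeff_map_poly_additive vector_space_additive h h.vs1.vector_space_axioms
    h.vs2.vector_space_axioms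
  show ?thesis
    by (intro Vector_Spaces.linear.intro module_hom.intro module_hom_axioms.intro
        vector_space_map_poly h.vs1.vector_space_axioms h.vs2.vector_space_axioms
        vector_space_map_poly[unfolded module_iff_vector_space[symmetric]] poly_eqI
        h.vs1.module_axioms h.vs2.module_axioms)
      (simp_all add: h.add h.scale)
qed

section \<open>Substituting an operator for the indeterminate\<close>

lemma additive_funpow:
  fixes S :: "'a::ab_group_add \<Rightarrow> 'a"
  assumes "Modules.additive S"
  shows "Modules.additive (S ^^ n)"
  by (induction n) (auto intro!: additive.intro simp: additive.add assms)

text \<open>
  The degree is not additive, so comparing substitutions into different polynomials requires a
  common range of summation.
\<close>

lemma subst_op_eq_sum:
  assumes "Modules.additive S" "Modules.additive e" "degree p \<le> n"
  shows "subst_op S e p = (\<Sum>i\<le>n. (S ^^ i) (e (coeff p i)))"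
  unfolding subst_op_def
  by (rule sum.mono_neutral_left)
    (use assms in \<open>auto simp: coeff_eq_0 additive.zero additive_funpow\<close>)

lemma additive_subst_op:
  fixes S :: "'b::ab_group_add \<Rightarrow> 'b" and e :: "'a::ab_group_add \<Rightarrow> 'b"
  assumes "Modules.additive S" "Modules.additive e"
  shows "Modules.additive (subst_op S e)"
proof (rule additive.intro)
  fix p q :: "'a poly"
  define n where "n = max (degree p) (degree q)"
  have "degree (p + q) \<le> n" "degree p \<le> n" "degree q \<le> n"
    using degree_add_le_max[of p q] by (auto simp: n_def)
  then show "subst_op S e (p + q) = subst_op S e p + subst_op S e q"
    by (simp add: subst_op_eq_sum[OF assms] additive.add[OF assms(2)]
        additive.add[OF additive_funpow[OF assms(1)]] sum.distrib)
qed

lemma subst_op_add_embedding: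
  assumes "Modules.additive S"
  shows "subst_op S (\<lambda>x. e x + e' x) p = subst_op S e p + subst_op S e' p"
  by (simp add: subst_op_def additive.add[OF additive_funpow[OF assms]] sum.distrib)

text \<open>
  Substitution is natural in the coefficients. Scalar multiplications for \<open>h\<close> and \<open>g\<close> make it
  homogeneous; \<open>T\<^sub>t\<close> makes iterated brackets compatible with \<open>T\<^sub>t\<close>.
\<close>

lemma subst_op_natural:
  assumes S: "Modules.additive S" and S': "Modules.additive S'" and e': "Modules.additive e'"
    and h: "Modules.additive h" and g: "Modules.additive g"
    and hS: "\<And>p. h (S p) = S' (h p)" and he: "\<And>x. h (e x) = e' (g x)"
  shows "h (subst_op S e p) = subst_op S' e' (map_poly g p)"
proof -
  have pow: "h ((S ^^ i) x) = (S' ^^ i) (h x)" for i x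
    by (induction i) (simp_all add: hS)
  have "degree (map_poly g p) \<le> degree p"
    by (rule degree_le) (simp add: coeff_map_poly_additive[OF g] coeff_eq_0 additive.zero[OF g])
  then show ?thesis
    by (simp add: subst_op_eq_sum[OF S' e'] subst_op_def[of S] additive.sum[OF h] pow he
        coeff_map_poly_additive[OF g])
qed

section \<open>Iterated brackets\<close>

lemma additive_mul_lam: "Modules.additive mul_lam"
  unfolding mul_lam_def by (intro additive_map_poly additive.intro) simp

lemma additive_mul_mu: "Modules.additive mul_mu"
  unfolding mul_mu_def by (intro additive.intro) simp

lemma additive_mul_lam_plus_mu: "Modules.additive (\<lambda>q. mul_lam q + mul_mu q)"
  by (intro additive.intro)
    (simp add: additive.add[OF additive_mul_lam] additive.add[OF additive_mul_mu])

lemma additive_const2: "Modules.additive const2"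
  unfolding const2_def by (intro additive.intro) simp

text \<open>
  All three terms of the Jacobi identity have this shape: \<open>p\<close> is the inner bracket, \<open>F\<close> is the outer
  bracket with one slot filled, and \<open>S\<close>, \<open>S'\<close> are the operators on \<open>R[\<lambda>,\<mu>]\<close> by which the inner
  and the outer indeterminate act.
\<close>

definition iterated_bracket ::
    "('a::ab_group_add poly poly \<Rightarrow> 'a poly poly) \<Rightarrow> ('a poly poly \<Rightarrow> 'a poly poly) \<Rightarrow>
     ('a \<Rightarrow> 'a poly) \<Rightarrow> 'a poly \<Rightarrow> 'a poly poly"
  where "iterated_bracket S S' F p = subst_op S (\<lambda>w. subst_op S' const2 (F w)) p"

text \<open>
  Multiplication by \<open>\<lambda>\<close>, \<open>\<mu>\<close> or \<open>\<lambda> + \<mu>\<close> moves the indeterminates and leaves the coefficients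
  alone, hence commutes with every map that acts on coefficients.
\<close>

definition polynomial_operator :: "('a::ab_group_add poly poly \<Rightarrow> 'a poly poly) \<Rightarrow> bool"
  where "polynomial_operator S \<longleftrightarrow> Modules.additive S \<and>
    (\<forall>h p. Modules.additive h \<longrightarrow>
      map_poly (map_poly h) (S p) = S (map_poly (map_poly h) p))"

lemma polynomial_operatorD:
  assumes "polynomial_operator S"
  shows "Modules.additive S"
    and "Modules.additive h \<Longrightarrow> map_poly (map_poly h) (S p) = S (map_poly (map_poly h) p)"
  using assms by (auto simp: polynomial_operator_def)

lemma polynomial_operator_mul_lam: "polynomial_operator mul_lam"
proof -
  have "map_poly (map_poly h) (mul_lam p) = mul_lam (map_poly (map_poly h) p)"
    if h: "Modules.additive h" for h :: "'a \<Rightarrow> 'a" and p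
    unfolding mul_lam_def
    by (intro map_poly_commute additive_map_poly h)
      (auto intro: additive.intro simp: map_poly_pCons_additive[OF h] additive.zero[OF h])
  then show ?thesis
    by (simp add: polynomial_operator_def additive_mul_lam)
qed

lemma polynomial_operator_mul_mu: "polynomial_operator mul_mu"
  unfolding polynomial_operator_def
  by (auto simp: additive_mul_mu) (simp add: mul_mu_def map_poly_pCons_additive additive_map_poly)

lemma polynomial_operator_mul_lam_plus_mu: "polynomial_operator (\<lambda>q. mul_lam q + mul_mu q)"
  using polynomial_operator_mul_lam polynomial_operator_mul_mu
  by (auto simp: polynomial_operator_def additive_mul_lam_plus_mu additive_map_poly additive.add)

lemmas polynomial_operators =
  polynomial_operator_mul_lam polynomial_operator_mul_mu polynomial_operator_mul_lam_plus_mu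

context
  fixes S S' :: "'a::ab_group_add poly poly \<Rightarrow> 'a poly poly"
  assumes S: "polynomial_operator S" and S': "polynomial_operator S'"
begin

lemma additive_subst_const2: "Modules.additive (subst_op S' const2)"
  by (intro additive_subst_op polynomial_operatorD S' additive_const2)

lemma additive_iterated_bracket_embedding:
  assumes "Modules.additive F"
  shows "Modules.additive (\<lambda>w. subst_op S' const2 (F w))"
  by (intro additive.intro)
    (simp add: additive.add[OF assms] additive.add[OF additive_subst_const2])

lemma map_subst_const2:
  assumes h: "Modules.additive h"
  shows "map_poly (map_poly h) (subst_op S' const2 p) = subst_op S' const2 (map_poly h p)"
  by (intro subst_op_natural polynomial_operatorD S' additive_const2 additive_map_poly h)
    (simp add: const2_def map_poly_pCons_additive h additive_map_poly)

lemma iterated_bracket_natural: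
  assumes T: "Modules.additive T" and F': "Modules.additive F'"
    and "\<And>w. map_poly T (F w) = F' (T w)"
  shows "map_poly (map_poly T) (iterated_bracket S S' F p) =
    iterated_bracket S S' F' (map_poly T p)"
  unfolding iterated_bracket_def
  by (intro subst_op_natural polynomial_operatorD S T additive_map_poly
      additive_iterated_bracket_embedding F')
    (simp add: map_subst_const2 T assms)

lemma iterated_bracket_add_inner:
  assumes "Modules.additive F"
  shows "iterated_bracket S S' F (p + q) =
    iterated_bracket S S' F p + iterated_bracket S S' F q"
  unfolding iterated_bracket_def
  by (intro additive.add additive_subst_op additive_iterated_bracket_embedding assms
      polynomial_operatorD S)

lemma iterated_bracket_map_inner:
  assumes h: "Modules.additive h" and F: "Modules.additive F"
    and "\<And>w. map_poly h (F w) = F (h w)"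
  shows "iterated_bracket S S' F (map_poly h p) =
    map_poly (map_poly h) (iterated_bracket S S' F p)"
  by (rule iterated_bracket_natural[symmetric]) (use assms in auto)

lemma iterated_bracket_add_outer:
  "iterated_bracket S S' (\<lambda>w. F w + G w) p =
    iterated_bracket S S' F p + iterated_bracket S S' G p"
  unfolding iterated_bracket_def
  by (simp add: additive.add[OF additive_subst_const2] subst_op_add_embedding
      polynomial_operatorD(1)[OF S])

lemma iterated_bracket_map_outer:
  assumes h: "Modules.additive h"
  shows "iterated_bracket S S' (\<lambda>w. map_poly h (F w)) p =
    map_poly (map_poly h) (iterated_bracket S S' F p)"
proof -
  have pow: "map_poly (map_poly h) ((S ^^ i) x) = (S ^^ i) (map_poly (map_poly h) x)" for i x
    by (induction i) (simp_all add: polynomial_operatorD(2)[OF S h])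
  show ?thesis
    by (simp add: iterated_bracket_def subst_op_def[of S] pow map_subst_const2 h
        additive.sum[OF additive_map_poly[OF additive_map_poly[OF h]]])
qed

end

section \<open>The polarised Jacobiator\<close>

lemma vector_space_cscale:
  assumes "module act"
  shows "vector_space (cscale act)"
proof -
  interpret module act by fact
  show ?thesis
    by unfold_locales
      (simp_all add: cscale_def scale_right_distrib scale_left_distrib[symmetric]
        mult.commute flip: one_pCons)
qed

lemma vector_space_pscale: "module act \<Longrightarrow> vector_space (pscale act)"
  using vector_space_map_poly[OF vector_space_cscale] by (simp add: pscale_def[abs_def])

lemma vector_space_pscale2: "module act \<Longrightarrow> vector_space (pscale2 act)"
  using vector_space_map_poly[OF vector_space_pscale] by (simp add: pscale2_def[abs_def])

text \<open>
  The Jacobiator of a single bracket \<open>P\<close> is the case \<open>P = Q\<close>; separating the outer bracket \<open>P\<close> from the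
  inner bracket \<open>Q\<close> makes it bilinear, which is what splits the Jacobiator of
  \<open>[\<cdot>,\<cdot>] + t \<psi>\<close> into powers of \<open>t\<close>. The scalars \<open>c\<close> and \<open>d\<close> stand for \<open>\<delta>\<close> and
  \<open>\<delta>(-1)\<^bsup>|a||b|\<^esup>\<close>.
\<close>

definition jacobiator ::
    "(complex poly \<Rightarrow> 'a::ab_group_add \<Rightarrow> 'a) \<Rightarrow> ('a \<Rightarrow> 'a) \<Rightarrow> complex \<Rightarrow> complex \<Rightarrow>
     ('a \<Rightarrow> 'a \<Rightarrow> 'a poly) \<Rightarrow> ('a \<Rightarrow> 'a \<Rightarrow> 'a poly) \<Rightarrow> 'a \<Rightarrow> 'a \<Rightarrow> 'a \<Rightarrow> 'a poly poly"
  where "jacobiator act \<alpha> c d P Q x y z =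
    iterated_bracket mul_mu mul_lam (P (\<alpha> x)) (Q y z) -
    pscale2 act c
      (iterated_bracket mul_lam (\<lambda>q. mul_lam q + mul_mu q) (\<lambda>w. P w (\<alpha> z)) (Q x y)) -
    pscale2 act d (iterated_bracket mul_lam mul_mu (P (\<alpha> y)) (Q x z))"

lemma jacobiator_eq_0_iff:
  "jacobiator act \<alpha> c d P P x y z = 0 \<longleftrightarrow>
    bracket_lam_mu P (\<alpha> x) y z =
      pscale2 act c (bracket_lam_plus_mu P x y (\<alpha> z)) +
      pscale2 act d (bracket_mu_lam P (\<alpha> y) x z)"
  unfolding jacobiator_def iterated_bracket_def bracket_lam_mu_def bracket_lam_plus_mu_def
    bracket_mu_lam_def
  by (auto simp: algebra_simps)

definition bilinear_bracket ::
    "(complex poly \<Rightarrow> 'a::ab_group_add \<Rightarrow> 'a) \<Rightarrow> ('a \<Rightarrow> 'a \<Rightarrow> 'a poly) \<Rightarrow> bool"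
  where "bilinear_bracket act P \<longleftrightarrow>
    (\<forall>a. Vector_Spaces.linear (cscale act) (pscale act) (P a)) \<and>
    (\<forall>b. Vector_Spaces.linear (cscale act) (pscale act) (\<lambda>a. P a b))"

lemma linear_additive: "Vector_Spaces.linear s s' h \<Longrightarrow> Modules.additive h"
  by (intro additive.intro) (simp add: linear_iff_module_hom module_hom.add)

lemma bilinear_bracket_additive:
  assumes "bilinear_bracket act P"
  shows "Modules.additive (P a)" "Modules.additive (\<lambda>a. P a b)"
  using assms by (auto simp: bilinear_bracket_def intro: linear_additive)

lemma bilinear_bracket_scale:
  assumes "bilinear_bracket act P"
  shows "P a (cscale act k b) = map_poly (cscale act k) (P a b)"
    and "P (cscale act k a) b = map_poly (cscale act k) (P a b)"
proof -
  have hom: "module_hom (cscale act) (pscale act) (P a)"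
    "module_hom (cscale act) (pscale act) (\<lambda>a. P a b)"
    using assms by (auto simp: bilinear_bracket_def linear_iff_module_hom)
  then show "P a (cscale act k b) = map_poly (cscale act k) (P a b)"
    and "P (cscale act k a) b = map_poly (cscale act k) (P a b)"
    using module_hom.scale[OF hom(1)] module_hom.scale[OF hom(2)] by (simp_all add: pscale_def)
qed

context
  fixes act :: "complex poly \<Rightarrow> 'a::ab_group_add \<Rightarrow> 'a"
  assumes act: "module act"
begin

lemma additive_cscale: "Modules.additive (cscale act k)"
  by (intro vector_space_additive vector_space_cscale act)

lemma pscale2_add: "pscale2 act k (u + v) = pscale2 act k u + pscale2 act k v"
  using vector_space.vector_space_assms(1)[OF vector_space_pscale2[OF act]] .

lemma pscale2_commute: "pscale2 act k (pscale2 act l u) = pscale2 act l (pscale2 act k u)"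
  using vector_space.vector_space_assms(3)[OF vector_space_pscale2[OF act]]
  by (simp add: mult.commute)

lemma pscale2_diff: "pscale2 act k (u - v) = pscale2 act k u - pscale2 act k v"
  by (intro additive.diff vector_space_additive vector_space_pscale2 act)

lemma jacobiator_deform_outer:
  "jacobiator act \<alpha> c d (deformed_bracket act P P' t) Q x y z =
    jacobiator act \<alpha> c d P Q x y z + pscale2 act t (jacobiator act \<alpha> c d P' Q x y z)"
proof -
  have *: "iterated_bracket S S' (\<lambda>w. F w + pscale act t (G w)) p =
      iterated_bracket S S' F p + pscale2 act t (iterated_bracket S S' G p)"
    if "polynomial_operator S" "polynomial_operator S'" for S S' F G and p :: "'a poly"
    using that
    by (simp add: iterated_bracket_add_outer iterated_bracket_map_outer additive_cscale
        pscale_def pscale2_def)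
  show ?thesis
    by (simp add: jacobiator_def deformed_bracket_def[abs_def] * polynomial_operators
        pscale2_add pscale2_diff pscale2_commute[of t])
qed

lemma jacobiator_deform_inner:
  assumes P: "bilinear_bracket act P"
  shows "jacobiator act \<alpha> c d P (deformed_bracket act Q Q' t) x y z =
    jacobiator act \<alpha> c d P Q x y z + pscale2 act t (jacobiator act \<alpha> c d P Q' x y z)"
proof -
  have *: "iterated_bracket S S' F (p + pscale act t q) =
      iterated_bracket S S' F p + pscale2 act t (iterated_bracket S S' F q)"
    if "polynomial_operator S" "polynomial_operator S'" "Modules.additive F"
      "\<And>w. map_poly (cscale act t) (F w) = F (cscale act t w)" for S S' F and p q :: "'a poly"
    using that
    by (simp add: iterated_bracket_add_inner iterated_bracket_map_inner additive_cscale
        pscale_def pscale2_def)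
  show ?thesis
    by (simp add: jacobiator_def deformed_bracket_def[abs_def] * polynomial_operators
        bilinear_bracket_additive[OF P] bilinear_bracket_scale[OF P]
        pscale2_add pscale2_diff pscale2_commute[of t])
qed

lemma jacobiator_natural:
  assumes T: "Vector_Spaces.linear (cscale act) (cscale act) T"
    and T\<alpha>: "\<And>a. T (\<alpha> a) = \<alpha> (T a)"
    and Q: "bilinear_bracket act Q"
    and TP: "\<And>a b. map_poly T (P a b) = Q (T a) (T b)"
  shows "map_poly (map_poly T) (jacobiator act \<alpha> c d P P x y z) =
    jacobiator act \<alpha> c d Q Q (T x) (T y) (T z)"
proof -
  have add: "Modules.additive T"
    using T by (rule linear_additive)
  have T2: "map_poly (map_poly T) (pscale2 act k u) = pscale2 act k (map_poly (map_poly T) u)"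
    for k u
    unfolding pscale2_def pscale_def
    by (intro map_poly_commute additive_map_poly add additive_cscale)
      (use T in \<open>simp add: linear_iff_module_hom module_hom.scale\<close>)
  have *: "map_poly (map_poly T) (iterated_bracket S S' F (P a b)) =
      iterated_bracket S S' G (Q (T a) (T b))"
    if "polynomial_operator S" "polynomial_operator S'" "Modules.additive G"
      "\<And>w. map_poly T (F w) = G (T w)" for S S' F G a b
    using iterated_bracket_natural[OF that(1,2) add that(3,4), of "P a b"] by (simp add: TP)
  show ?thesis
    unfolding jacobiator_def additive.diff[OF additive_map_poly[OF additive_map_poly[OF add]]] T2
    by (intro arg_cong2[where f = minus] arg_cong[where f = "pscale2 act _"] *
        polynomial_operators bilinear_bracket_additive[OF Q])
      (simp_all add: TP T\<alpha>)
qed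

end

section \<open>Comparing powers of the deformation parameter\<close>

text \<open>
  Multiplying out gives \<open>t A + t\<^sup>2 (B + F A) + t\<^sup>3 F B = 0\<close>, whose three coefficients vanish; then
  \<open>A = 0\<close> and \<open>B = - F A = 0\<close>. The values \<open>t = 1, -1, 2\<close> separate the coefficients.
\<close>

lemma quadratic_family_eq_0:
  fixes s :: "complex \<Rightarrow> 'v::ab_group_add \<Rightarrow> 'v"
  assumes F: "Vector_Spaces.linear s s F"
    and eq: "\<And>t. (s t A + s (t * t) B) + s t (F (s t A + s (t * t) B)) = 0"
  shows "A = 0" "B = 0"
proof -
  interpret Vector_Spaces.linear s s F by fact
  have eq': "s t A + s (t * t) (B + F A) + s (t * t * t) (F B) = 0" for t
    using eq[of t] by (simp add: add scale vs1.scale_right_distrib add.assoc mult.assoc)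
  have e1: "A + (B + F A) + F B = 0"
    using eq'[of 1] by simp
  have e2: "- A + (B + F A) - F B = 0"
    using eq'[of "-1"] by simp
  \<comment> \<open>The sum of the values at \<open>1\<close> and \<open>-1\<close> isolates the even part in \<open>t\<close>.\<close>
  have "s 2 (B + F A) = (A + (B + F A) + F B) + (- A + (B + F A) - F B)"
    using vs1.scale_left_distrib[of 1 1] by (simp add: algebra_simps)
  then have BFA: "B + F A = 0"
    unfolding e1 e2 by simp
  with e1 have AFB: "A = - F B"
    by (simp add: eq_neg_iff_add_eq_0)
  from eq'[of 2] BFA AFB have "s 8 (F B) - s 2 (F B) = 0"
    by simp
  then have "s 6 (F B) = 0"
    by (simp flip: vs1.scale_left_diff_distrib)
  then show A: "A = 0"
    using AFB by simp
  with BFA show "B = 0"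
    by simp
qed

section \<open>Deforming along a Hom-Nijenhuis operator\<close>

lemma additive_ddel: "module act \<Longrightarrow> Modules.additive (ddel act)"
  unfolding ddel_def by (intro additive.intro) (simp add: module.scale_right_distrib)

lemma additive_swap_operator:
  assumes "module act"
  shows "Modules.additive (\<lambda>p. - pCons 0 p - map_poly (ddel act) p)"
proof (rule additive.intro)
  fix p q
  show "- pCons 0 (p + q) - map_poly (ddel act) (p + q) =
    - pCons 0 p - map_poly (ddel act) p + (- pCons 0 q - map_poly (ddel act) q)"
    using additive.add[OF additive_map_poly[OF additive_ddel[OF assms]], of p q]
      add_pCons[of 0 p 0 q]
    by simp
qed

text \<open>
  Both \<open>f\<close> and the scalars commute with \<open>\<partial>\<close>, so they pass through \<open>[b\<^bsub>-\<lambda>-\<partial>\<^esub> a]\<close>; this is why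
  skew-symmetry is inherited by everything built linearly from the bracket.
\<close>

lemma additive_const_poly: "Modules.additive (\<lambda>x. [:x:])"
  by (rule additive.intro) simp

lemma swapped_bracket_add:
  assumes "module act" "P b a = Q b' a' + Q' b'' a''"
  shows "swapped_bracket act P b a = swapped_bracket act Q b' a' + swapped_bracket act Q' b'' a''"
  unfolding swapped_bracket_def assms(2)
  by (rule additive.add)
    (intro additive_subst_op additive_swap_operator additive_const_poly assms(1))

lemma swapped_bracket_map:
  assumes act: "module act" and h: "Modules.additive h"
    and hd: "\<And>x. h (ddel act x) = ddel act (h x)"
    and P: "P b a = map_poly h (Q b' a')"
  shows "swapped_bracket act P b a = map_poly h (swapped_bracket act Q b' a')"
  unfolding swapped_bracket_def P
proof (rule subst_op_natural[symmetric])
  fix p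
  show "map_poly h (- pCons 0 p - map_poly (ddel act) p) =
    - pCons 0 (map_poly h p) - map_poly (ddel act) (map_poly h p)"
    by (simp add: additive.diff[OF additive_map_poly[OF h]] additive.minus[OF additive_map_poly[OF h]]
        map_poly_pCons_additive[OF h] additive.zero[OF h]
        map_poly_commute[OF h additive_ddel[OF act] hd])
qed ((rule additive_swap_operator[OF act] additive_const_poly additive_map_poly[OF h] h
    | simp add: map_poly_pCons_additive[OF h])+)

locale hom_nijenhuis = hom_jordan_lie_conformal_superalgebra act Rg \<delta> \<alpha> br
  for act :: "complex poly \<Rightarrow> 'a::ab_group_add \<Rightarrow> 'a" and Rg \<delta> \<alpha> br +
  fixes f :: "'a \<Rightarrow> 'a"
  assumes nijenhuis: "hom_nijenhuis_operator act Rg \<alpha> br f"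
begin

abbreviation "N \<equiv> nijenhuis_bracket br f"
abbreviation "br_t t \<equiv> deformed_bracket act br N t"
abbreviation "T t \<equiv> id_plus act f t"

lemma f_hom: "module_hom act act f"
  and f_even: "x \<in> Rg p \<Longrightarrow> f x \<in> Rg p"
  and f_alpha: "f (\<alpha> x) = \<alpha> (f x)"
  and f_nijenhuis: "br (f a) (f b) = map_poly f (N a b)"
  using nijenhuis unfolding hom_nijenhuis_operator_def by (auto simp: fun_eq_iff)

lemma f_ddel: "f (ddel act x) = ddel act (f x)"
  and f_cscale: "f (cscale act k x) = cscale act k (f x)"
  by (simp_all add: ddel_def cscale_def module_hom.scale[OF f_hom])

lemmas vs0 = vector_space_cscale[OF module_axioms]
lemmas vs1 = vector_space_pscale[OF module_axioms]

lemma f_linear: "Vector_Spaces.linear (cscale act) (cscale act) f"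
  using vs0 f_cscale module_hom.add[OF f_hom]
  by (simp add: linear_iff_module_hom module_hom_iff module_iff_vector_space)

lemmas f_additive = linear_additive[OF f_linear]

lemma ddel_cscale: "ddel act (cscale act k x) = cscale act k (ddel act x)"
  by (simp add: ddel_def cscale_def mult.commute)

lemma id_plus_linear: "Vector_Spaces.linear (cscale act) (cscale act) (T t)"
proof -
  interpret vector_space_pair "cscale act" "cscale act"
    using vs0 by (simp add: vector_space_pair_def)
  show ?thesis
    unfolding id_plus_def[abs_def]
    by (intro linear_compose_add linear_compose_scale_right f_linear vs1.linear_ident)
qed

lemma map_poly_id_plus: "map_poly (T t) p = p + pscale act t (map_poly f p)"
  by (intro poly_eqI)
    (simp add: coeff_map_poly_additive linear_additive[OF id_plus_linear] pscale_def
      additive_cscale[OF module_axioms] f_additive id_plus_def)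

lemma br_bilinear: "bilinear_bracket act br"
  using br_linear_left br_linear_right by (simp add: bilinear_bracket_def)

lemma N_bilinear: "bilinear_bracket act N"
proof -
  interpret vector_space_pair "cscale act" "pscale act"
    using vs0 vs1 by (simp add: vector_space_pair_def)
  have fp: "Vector_Spaces.linear (pscale act) (pscale act) (map_poly f)"
    using linear_map_poly[OF f_linear] by (simp add: pscale_def[abs_def])
  show ?thesis
    unfolding bilinear_bracket_def nijenhuis_bracket_def[abs_def]
    using br_linear_left br_linear_right
      Vector_Spaces.linear_compose[OF f_linear br_linear_left] Vector_Spaces.linear_compose[OF f_linear br_linear_right]
      Vector_Spaces.linear_compose[OF br_linear_left fp] Vector_Spaces.linear_compose[OF br_linear_right fp]
    by (auto simp: o_def intro!: linear_compose_add linear_compose_sub)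
qed

lemma br_t_bilinear: "bilinear_bracket act (br_t t)"
proof -
  interpret vector_space_pair "cscale act" "pscale act"
    using vs0 vs1 by (simp add: vector_space_pair_def)
  show ?thesis
    using br_bilinear N_bilinear
    unfolding bilinear_bracket_def deformed_bracket_def[abs_def]
    by (auto intro!: linear_compose_add linear_compose_scale_right)
qed

text \<open>
  The coefficients of \<open>t\<close> agree because \<open>[\<cdot>,\<cdot>]\<^sub>N + f[\<cdot>,\<cdot>]\<close> is the Leibniz expression
  \<open>[f a, b] + [a, f b]\<close>, those of \<open>t\<^sup>2\<close> by the Nijenhuis identity.
\<close>

lemma id_plus_deformed_bracket: "map_poly (T t) (br_t t a b) = br (T t a) (T t b)"
proof -
  note vs = vector_space.vector_space_assms[OF vs1]
  note badd = additive.add[OF bilinear_bracket_additive(1)[OF br_bilinear]]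
    additive.add[OF bilinear_bracket_additive(2)[OF br_bilinear]]
  note bsc = bilinear_bracket_scale[OF br_bilinear, folded pscale_def]
  have fs: "map_poly f (pscale act t p) = pscale act t (map_poly f p)" for p
    unfolding pscale_def
    by (intro map_poly_commute f_additive additive_cscale module_axioms f_cscale)
  have fa: "map_poly f (p + q) = map_poly f p + map_poly f q" for p q
    by (rule additive.add[OF additive_map_poly[OF f_additive]])
  have "map_poly (T t) (br_t t a b) =
      br a b + pscale act t (N a b + map_poly f (br a b)) +
      pscale act t (pscale act t (map_poly f (N a b)))"
    by (simp add: map_poly_id_plus deformed_bracket_def fa fs vs(1) add_ac)
  also have "N a b + map_poly f (br a b) = br (f a) b + br a (f b)"
    by (simp add: nijenhuis_bracket_def)
  also have "br a b + pscale act t (br (f a) b + br a (f b)) +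
      pscale act t (pscale act t (map_poly f (N a b))) = br (T t a) (T t b)"
    by (simp add: id_plus_def badd bsc f_nijenhuis vs(1) add_ac)
  finally show ?thesis .
qed

lemma skew_nijenhuis:
  assumes a: "a \<in> Rg p" and b: "b \<in> Rg q"
  shows "N a b = pscale act (- \<delta> * psign p q) (swapped_bracket act N b a)"
proof -
  define s where "s = pscale act (- \<delta> * psign p q)"
  have add: "Modules.additive s"
    unfolding s_def by (intro vector_space_additive vs1)
  have sf: "s (map_poly f u) = map_poly f (s u)" for u
    unfolding s_def pscale_def
    by (intro map_poly_commute f_additive additive_cscale module_axioms f_cscale[symmetric])
  \<comment> \<open>The sign goes into the coefficient map, so that additivity alone splits the difference.\<close>
  have "swapped_bracket act N b a =
      swapped_bracket act (\<lambda>b a. br (f b) a + br b (f a)) b a +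
      swapped_bracket act (\<lambda>b a. map_poly (\<lambda>x. - f x) (br b a)) b a"
    by (intro swapped_bracket_add[OF module_axioms] poly_eqI)
      (simp add: nijenhuis_bracket_def coeff_map_poly_additive f_additive coeff_map_poly
        additive.zero)
  also have "swapped_bracket act (\<lambda>b a. br (f b) a + br b (f a)) b a =
      swapped_bracket act br (f b) a + swapped_bracket act br b (f a)"
    by (intro swapped_bracket_add[OF module_axioms]) simp
  also have "swapped_bracket act (\<lambda>b a. map_poly (\<lambda>x. - f x) (br b a)) b a =
      map_poly (\<lambda>x. - f x) (swapped_bracket act br b a)"
    by (intro swapped_bracket_map[OF module_axioms] additive.intro)
      (simp_all add: additive.add[OF f_additive] f_ddel additive.minus[OF additive_ddel[OF module_axioms]])
  also have "\<dots> = - map_poly f (swapped_bracket act br b a)"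
    by (intro poly_eqI) (simp add: coeff_map_poly additive.zero[OF f_additive])
  finally have "s (swapped_bracket act N b a) =
      s (swapped_bracket act br b (f a)) + s (swapped_bracket act br (f b) a) -
      map_poly f (s (swapped_bracket act br b a))"
    by (simp add: additive.add[OF add] additive.diff[OF add] sf)
  then show ?thesis
    using skew[OF a b] skew[OF f_even[OF a] b] skew[OF a f_even[OF b]]
    by (simp add: nijenhuis_bracket_def s_def)
qed

lemma skew_deformed:
  assumes a: "a \<in> Rg p" and b: "b \<in> Rg q"
  shows "br_t t a b = pscale act (- \<delta> * psign p q) (swapped_bracket act (br_t t) b a)"
proof -
  note vs = vector_space.vector_space_assms[OF vs1]
  have "swapped_bracket act (br_t t) b a =
      swapped_bracket act br b a + swapped_bracket act (\<lambda>b a. pscale act t (N b a)) b a"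
    by (intro swapped_bracket_add[OF module_axioms]) (simp add: deformed_bracket_def)
  also have "swapped_bracket act (\<lambda>b a. pscale act t (N b a)) b a =
      pscale act t (swapped_bracket act N b a)"
    unfolding pscale_def
    by (intro swapped_bracket_map[OF module_axioms] additive_cscale[OF module_axioms]
        ddel_cscale[symmetric]) simp
  finally have swapped: "swapped_bracket act (br_t t) b a =
      swapped_bracket act br b a + pscale act t (swapped_bracket act N b a)" .
  show ?thesis
    unfolding swapped deformed_bracket_def[of act br N t a b]
    by (subst skew[OF a b], subst skew_nijenhuis[OF a b]) (simp add: vs(1) vs(3) mult_ac)
qed

text \<open>
  \<open>T\<^sub>t\<close> kills the Jacobiator \<open>t A + t\<^sup>2 B\<close> of the deformed bracket for every \<open>t\<close>; read as an identity
  of polynomials in \<open>t\<close>, this forces \<open>A = B = 0\<close>.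
\<close>

lemma jacobiator_deformed_eq_0:
  assumes a: "a \<in> Rg p" and b: "b \<in> Rg q" and c: "c \<in> Rg r"
  shows "jacobiator act \<alpha> \<delta> (\<delta> * psign p q) (br_t t) (br_t t) a b c = 0"
proof -
  define J where "J P Q = jacobiator act \<alpha> \<delta> (\<delta> * psign p q) P Q" for P Q
  define A where "A = J br N a b c + J N br a b c"
  define B where "B = J N N a b c"
  define F where "F = map_poly (map_poly f)"
  have J0: "J br br x y z = 0" if "x \<in> Rg p" "y \<in> Rg q" "z \<in> Rg r" for x y z
    unfolding J_def jacobiator_eq_0_iff by (rule hom_jacobi[OF that])
  note vs = vector_space.vector_space_assms[OF vector_space_pscale2[OF module_axioms]]
  have outer: "J (br_t t) Q a b c = J br Q a b c + pscale2 act t (J N Q a b c)" for t Q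
    unfolding J_def by (rule jacobiator_deform_outer[OF module_axioms])
  have inner: "J P (br_t t) a b c = J P br a b c + pscale2 act t (J P N a b c)"
    if "bilinear_bracket act P" for t P
    unfolding J_def by (rule jacobiator_deform_inner[OF module_axioms that])
  have Jt: "J (br_t t) (br_t t) a b c = pscale2 act t A + pscale2 act (t * t) B" for t
    unfolding outer inner[OF br_bilinear] inner[OF N_bilinear] J0[OF a b c] A_def B_def
    by (simp add: vs(1) vs(3) add_ac)
  have T_even: "T t x \<in> Rg s" if "x \<in> Rg s" for t x s
    unfolding id_plus_def cscale_def
    by (intro subspace_add subspace_scale graded_submodule that f_even)
  have T_alpha: "T t (\<alpha> x) = \<alpha> (T t x)" for t x
    using alpha_linear
    by (simp add: id_plus_def f_alpha linear_iff_module_hom module_hom.add module_hom.scale)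
  have "map_poly (map_poly (T t)) (J (br_t t) (br_t t) a b c) = J br br (T t a) (T t b) (T t c)"
    for t
    unfolding J_def
    by (rule jacobiator_natural[OF module_axioms id_plus_linear _ br_bilinear])
      (rule T_alpha id_plus_deformed_bracket)+
  then have "map_poly (map_poly (T t)) (J (br_t t) (br_t t) a b c) = 0" for t
    using J0[OF T_even[OF a] T_even[OF b] T_even[OF c]] by simp
  moreover have "map_poly (map_poly (T t)) u = u + pscale2 act t (F u)" for t u
    by (intro poly_eqI)
      (simp add: coeff_map_poly_additive additive_map_poly F_def pscale2_def pscale_def
        linear_additive[OF id_plus_linear] additive_cscale[OF module_axioms] f_additive
        id_plus_def)
  ultimately have *: "(pscale2 act t A + pscale2 act (t * t) B) +
      pscale2 act t (F (pscale2 act t A + pscale2 act (t * t) B)) = 0" for t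
    using Jt by simp
  have F: "Vector_Spaces.linear (pscale2 act) (pscale2 act) F"
    using linear_map_poly[OF linear_map_poly[OF f_linear]]
    unfolding F_def pscale2_def[abs_def] pscale_def[abs_def] .
  have "A = 0" "B = 0"
    using quadratic_family_eq_0[OF F, of A B] * by blast+
  then have "J (br_t t) (br_t t) a b c = 0"
    unfolding Jt by (simp add: additive.zero vector_space_additive[OF vector_space_pscale2[OF module_axioms]])
  then show ?thesis
    unfolding J_def .
qed

lemma deformed_sesqui:
  "br_t t (ddel act a) b = - pCons 0 (br_t t a b)"
  "br_t t a (ddel act b) = map_poly (ddel act) (br_t t a b) + pCons 0 (br_t t a b)"
proof -
  have fd: "map_poly f (map_poly (ddel act) u) = map_poly (ddel act) (map_poly f u)" for u
    by (intro map_poly_commute f_additive additive_ddel module_axioms f_ddel)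
  have sd: "pscale act t (map_poly (ddel act) u) = map_poly (ddel act) (pscale act t u)" for u
    unfolding pscale_def
    by (intro map_poly_commute additive_cscale additive_ddel module_axioms ddel_cscale[symmetric])
  note lin = additive.add additive.diff additive.minus
  note f = lin[OF additive_map_poly[OF f_additive]]
  note s = lin[OF vector_space_additive[OF vs1]]
  note d = lin[OF additive_map_poly[OF additive_ddel[OF module_axioms]]]
  have fp: "map_poly f (pCons 0 u) = pCons 0 (map_poly f u)" for u
    by (simp add: map_poly_pCons_additive f_additive additive.zero[OF f_additive])
  have sp: "pscale act t (pCons 0 u) = pCons 0 (pscale act t u)" for u
    using additive.zero[OF additive_cscale[OF module_axioms, of t]]
    by (simp add: map_poly_pCons pscale_def)
  have pC: "pCons (0::'a) (u + v) = pCons 0 u + pCons 0 v"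
      "pCons (0::'a) (u - v) = pCons 0 u - pCons 0 v" for u v
    by simp_all
  show "br_t t (ddel act a) b = - pCons 0 (br_t t a b)"
    unfolding deformed_bracket_def nijenhuis_bracket_def f_ddel sesqui_left f s fp sp pC
    by (simp del: add_pCons diff_pCons minus_pCons)
  show "br_t t a (ddel act b) = map_poly (ddel act) (br_t t a b) + pCons 0 (br_t t a b)"
    unfolding deformed_bracket_def nijenhuis_bracket_def f_ddel sesqui_right f s d fp sp fd sd pC
    by (simp del: add_pCons diff_pCons minus_pCons)
qed

lemma deformed_graded:
  assumes a: "a \<in> Rg p" and b: "b \<in> Rg q"
  shows "coeff (br_t t a b) n \<in> Rg (p + q)"
  using br_graded[OF a b] br_graded[OF f_even[OF a] b] br_graded[OF a f_even[OF b]]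
  by (auto simp: deformed_bracket_def nijenhuis_bracket_def pscale_def coeff_map_poly_additive
      additive_cscale module_axioms f_additive cscale_def
      intro!: subspace_add subspace_diff subspace_scale graded_submodule f_even)

lemma deformed_superalgebra: "hom_jordan_lie_conformal_superalgebra act Rg \<delta> \<alpha> (br_t t)"
proof (intro hom_jordan_lie_conformal_superalgebra.intro
    hom_jordan_lie_conformal_superalgebra_axioms.intro)
  show "Vector_Spaces.linear (cscale act) (pscale act) (\<lambda>b. br_t t a b)"
    "Vector_Spaces.linear (cscale act) (pscale act) (\<lambda>a. br_t t a b)" for a b
    using br_t_bilinear by (simp_all add: bilinear_bracket_def)
qed (fact graded_del_module_axioms delta alpha_linear alpha_even alpha_ddel deformed_graded
    deformed_sesqui skew_deformed jacobiator_deformed_eq_0[unfolded jacobiator_eq_0_iff])+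

end

theorem theorem3p4:
  fixes act :: "complex poly \<Rightarrow> 'a::ab_group_add \<Rightarrow> 'a"
    and Rg :: "bit \<Rightarrow> 'a set"
    and \<delta> :: complex
    and \<alpha> f :: "'a \<Rightarrow> 'a"
    and br \<psi> :: "'a \<Rightarrow> 'a \<Rightarrow> 'a poly"
  assumes "regular_hom_jordan_lie_conformal_superalgebra act Rg \<delta> \<alpha> br"
    and "hom_nijenhuis_operator act Rg \<alpha> br f"
    and "\<And>a b. \<psi> a b = nijenhuis_bracket br f a b"
  shows "generates_deformation act Rg \<delta> \<alpha> br \<psi> \<and>
    (\<forall>t a b. map_poly (id_plus act f t) (deformed_bracket act br \<psi> t a b) =
      br (id_plus act f t a) (id_plus act f t b))"
proof -
  interpret regular_hom_jordan_lie_conformal_superalgebra act Rg \<delta> \<alpha> br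
    by fact
  interpret hom_nijenhuis act Rg \<delta> \<alpha> br f
    by unfold_locales (rule assms(2))
  have "\<psi> = N"
    using assms(3) by (simp add: fun_eq_iff)
  then show ?thesis
    using deformed_superalgebra id_plus_deformed_bracket
    by (simp add: generates_deformation_def)
qed

end
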